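(* Let $\mathfrak{P}_{\mathrm{sg}}=\mathfrak{P}_{\mathrm{sg}}(M,\sigma,\bar K)$ be the sub-Gaussian instance class with fixed constants $M,\sigma>0$, $\bar K\ge 2$. There exists a constant $C>0$, depending only on $\mathfrak{P}_{\mathrm{sg}}$ (i.e. on $M,\sigma,\bar K$) and not on the algorithm, such that every active-learning bandit algorithm satisfies $$\liminf_{T\to\infty}\frac{\mathcal{R}_T\cdot\mathcal{S}_T}{T^{3/2}}>C .$$
   Context: Stochastic multi-armed bandit. There are $K$ arms; for each arm $i\in[K]=\{1,\dots,K\}$, $(X^i_s)_{s\ge1}$ is an i.i.d. reward sequence with law $\nu_i$, independent across arms; $\nu=(\nu_1,\dots,\nu_K)$ is the (unknown) bandit instance. For a horizon $T$, an algorithm selects at each time $t\in[T]$ an arm $A_t\sim\pi_t(\cdot\mid\mathcal H_{t-1})$, where $\mathcal H_{t-1}=(A_1,r_1,\dots,A_{t-1},r_{t-1})$ is the observed history, $\pi_t(\cdot\mid \mathcal H_{t-1})$ is a distribution on $[K]$, $N_{i,t}=\sum_{s=1}^t\mathbf 1\{A_s=i\}$, and $r_t=X^{A_t}_{N_{A_t,t}}$. An algorithm thus specifies decision rules $(\pi_t)_{t\in[T]}$ for every horizon $T$ and every number of arms $K$ (the rules may depend on $T$, $K$). Let $\mu_i$ be the mean of $\nu_i$, $\Delta_i=\max_j\mu_j-\mu_i$. Regret: $R_T(\nu)=\sum_{i=1}^K\Delta_i\,\mathbb E[N_{i,T}]$. Allocation variability: $S_T(\nu)=\max_{i\in[K]}\sqrt{\operatorname{Var}(N_{i,T})}$.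 $\mathfrak{P}_{\mathrm{sg}}(M,\sigma,\bar K)$ is the class of instances $\nu=(\nu_1,\dots,\nu_K)$ with $2\le K\le\bar K$ such that each $\nu_i$ has mean $\mu_i\in[-M,M]$ and is $\sigma$-sub-Gaussian. Worst-case metrics: $\mathcal R_T=\sup_{\nu\in\mathfrak{P}_{\mathrm{sg}}}R_T(\nu)$, $\mathcal S_T=\sup_{\nu\in\mathfrak{P}_{\mathrm{sg}}}S_T(\nu)$. Standing assumptions on algorithms: (i) if $\nu_i=\nu_j$ for some $i\ne j$ then $\mathbb E[N_{i,T}]=\mathbb E[N_{j,T}]$; (ii) for $T\ge K$, $\mathbb E[N_{i,T}]\ge1$ for each arm $i$. An algorithm is active-learning (over $\mathfrak{P}_{\mathrm{sg}}$) if $\lim_{T\to\infty}\mathcal R_T/T=0$. *)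

theory Defs
  imports "HOL-Probability.Probability"
begin

text \<open>
  A bandit instance is the list of its reward laws. Arms are numbered from 0, so that the
  arms of \<open>\<nu>\<close> are \<open>{..<length \<nu>}\<close> and arm \<open>i\<close> has law \<open>\<nu> ! i\<close>.
\<close>

type_synonym instance_laws = "real measure list"

definition mean :: "real measure \<Rightarrow> real" where
  "mean \<mu> = (\<integral>x. x \<partial>\<mu>)"

text \<open>
  Integrability is required explicitly because the integral of a non-integrable function is 0.
\<close>

definition sub_gaussian :: "real \<Rightarrow> real measure \<Rightarrow> bool" where
  "sub_gaussian \<sigma> \<mu> \<longleftrightarrow>
     (\<forall>l. integrable \<mu> (\<lambda>x. exp (l * (x - mean \<mu>))) \<and>
          (\<integral>x. exp (l * (x - mean \<mu>)) \<partial>\<mu>) \<le> exp (l\<^sup>2 * \<sigma>\<^sup>2 / 2))"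

definition P_sg :: "real \<Rightarrow> real \<Rightarrow> nat \<Rightarrow> instance_laws set" where
  "P_sg M \<sigma> Kbar =
     {\<nu>. 2 \<le> length \<nu> \<and> length \<nu> \<le> Kbar \<and>
         (\<forall>\<mu>\<in>set \<nu>. prob_space \<mu> \<and> sets \<mu> = sets borel \<and> integrable \<mu> (\<lambda>x. x) \<and>
            mean \<mu> \<in> {- M..M} \<and> sub_gaussian \<sigma> \<mu>)}"

text \<open>
  A history lists the pairs (arm, reward) in chronological order. For an algorithm \<open>alg\<close>,
  \<open>alg T K h\<close> is the distribution of the arm selected in round \<open>length h + 1\<close> after observing
  the history \<open>h\<close>, for horizon \<open>T\<close> and \<open>K\<close> arms.
\<close>

type_synonym history = "(nat \<times> real) list"
type_synonym algorithm = "nat \<Rightarrow> nat \<Rightarrow> history \<Rightarrow> nat pmf"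

text \<open>
  Decision rules are probability kernels from histories to arms. Histories of length \<open>t\<close> carry
  the product sigma-algebra, through their enumeration by \<open>{..<t}\<close>.
\<close>

definition decision_rules :: "algorithm \<Rightarrow> bool" where
  "decision_rules alg \<longleftrightarrow>
     (\<forall>K\<ge>1. \<forall>T. \<forall>t<T.
        (\<forall>h. length h = t \<longrightarrow> fst ` set h \<subseteq> {..<K} \<longrightarrow> set_pmf (alg T K h) \<subseteq> {..<K}) \<and>
        (\<lambda>h. measure_pmf (alg T K (map h [0..<t])))
          \<in> (\<Pi>\<^sub>M s\<in>{..<t}. count_space {..<K} \<Otimes>\<^sub>M borel) \<rightarrow>\<^sub>M subprob_algebra (count_space UNIV))"

text \<open>
  The table of rewards: the entry \<open>(i, s)\<close> is the reward of the pull number \<open>s + 1\<close> of arm \<open>i\<close>.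
\<close>

definition reward_table :: "instance_laws \<Rightarrow> (nat \<times> nat \<Rightarrow> real) measure" where
  "reward_table \<nu> = (\<Pi>\<^sub>M (i, s) \<in> {..<length \<nu>} \<times> UNIV. \<nu> ! i)"

text \<open>
  The law of the history after \<open>t\<close> rounds, conditionally on the reward table \<open>X\<close>. The index of
  the reward received from arm \<open>a\<close> is the number of earlier pulls of \<open>a\<close>, since the entries of
  the table are numbered from 0.
\<close>

primrec history_pmf :: "(history \<Rightarrow> nat pmf) \<Rightarrow> (nat \<times> nat \<Rightarrow> real) \<Rightarrow> nat \<Rightarrow> history pmf" where
  "history_pmf \<pi> X 0 = return_pmf []"
| "history_pmf \<pi> X (Suc t) =
     bind_pmf (history_pmf \<pi> X t)
       (\<lambda>h. map_pmf (\<lambda>a. h @ [(a, X (a, count_list (map fst h) a))]) (\<pi> h))"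

text \<open>
  The unconditional law of the sequence of arms \<open>A\<^sub>1, \<dots>, A\<^sub>T\<close>.
\<close>

definition action_law :: "algorithm \<Rightarrow> instance_laws \<Rightarrow> nat \<Rightarrow> nat list measure" where
  "action_law alg \<nu> T =
     reward_table \<nu> \<bind>
       (\<lambda>X. measure_pmf (map_pmf (map fst) (history_pmf (alg T (length \<nu>)) X T)))"

definition num_pulls :: "nat \<Rightarrow> nat list \<Rightarrow> real" where
  "num_pulls i as = real (count_list as i)"

definition expected_pulls :: "algorithm \<Rightarrow> instance_laws \<Rightarrow> nat \<Rightarrow> nat \<Rightarrow> real" where
  "expected_pulls alg \<nu> T i = prob_space.expectation (action_law alg \<nu> T) (num_pulls i)"

definition variance_pulls :: "algorithm \<Rightarrow> instance_laws \<Rightarrow> nat \<Rightarrow> nat \<Rightarrow> real" where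
  "variance_pulls alg \<nu> T i = prob_space.variance (action_law alg \<nu> T) (num_pulls i)"

definition gap :: "instance_laws \<Rightarrow> nat \<Rightarrow> real" where
  "gap \<nu> i = (MAX j\<in>{..<length \<nu>}. mean (\<nu> ! j)) - mean (\<nu> ! i)"

definition regret :: "algorithm \<Rightarrow> instance_laws \<Rightarrow> nat \<Rightarrow> real" where
  "regret alg \<nu> T = (\<Sum>i<length \<nu>. gap \<nu> i * expected_pulls alg \<nu> T i)"

definition variability :: "algorithm \<Rightarrow> instance_laws \<Rightarrow> nat \<Rightarrow> real" where
  "variability alg \<nu> T = (MAX i\<in>{..<length \<nu>}. sqrt (variance_pulls alg \<nu> T i))"

definition worst_regret :: "real \<Rightarrow> real \<Rightarrow> nat \<Rightarrow> algorithm \<Rightarrow> nat \<Rightarrow> ereal" where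
  "worst_regret M \<sigma> Kbar alg T = (SUP \<nu>\<in>P_sg M \<sigma> Kbar. ereal (regret alg \<nu> T))"

definition worst_variability :: "real \<Rightarrow> real \<Rightarrow> nat \<Rightarrow> algorithm \<Rightarrow> nat \<Rightarrow> ereal" where
  "worst_variability M \<sigma> Kbar alg T = (SUP \<nu>\<in>P_sg M \<sigma> Kbar. ereal (variability alg \<nu> T))"

definition bandit_algorithm :: "real \<Rightarrow> real \<Rightarrow> nat \<Rightarrow> algorithm \<Rightarrow> bool" where
  "bandit_algorithm M \<sigma> Kbar alg \<longleftrightarrow>
     decision_rules alg \<and>
     (\<forall>\<nu>\<in>P_sg M \<sigma> Kbar. \<forall>T.
        (\<forall>i<length \<nu>. \<forall>j<length \<nu>. \<nu> ! i = \<nu> ! j \<longrightarrow>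
           expected_pulls alg \<nu> T i = expected_pulls alg \<nu> T j) \<and>
        (length \<nu> \<le> T \<longrightarrow> (\<forall>i<length \<nu>. 1 \<le> expected_pulls alg \<nu> T i)))"

definition active_learning :: "real \<Rightarrow> real \<Rightarrow> nat \<Rightarrow> algorithm \<Rightarrow> bool" where
  "active_learning M \<sigma> Kbar alg \<longleftrightarrow>
     (\<lambda>T. worst_regret M \<sigma> Kbar alg T / ereal (real T)) \<longlonglongrightarrow> 0"

end

theory Submission
  imports Defs
begin

text \<open>
  Take two arms with rewards in \<open>{-a, a}\<close>, the first centred and the second with mean \<open>a * \<theta>\<close>.
  At \<open>\<theta> = 0\<close> the arms are exchangeable, so the first one is pulled \<open>T / 2\<close> times on average,
  whereas at \<open>\<Theta> = 4 * R / (a * T)\<close>, with \<open>R\<close> the worst-case regret, the regret bound leaves it at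
  most \<open>T / 4\<close> pulls. Active learning makes \<open>\<Theta>\<close> small. The expected number of pulls hence has
  slope of order \<open>T / \<Theta>\<close> somewhere on \<open>[0, \<Theta>]\<close>, while by a Cramer-Rao type inequality
  the slope is at most the standard deviation of the number of pulls times the square root of the
  Fisher information, which is of order \<open>T\<close>. So the standard deviation is of order
  \<open>sqrt T / \<Theta>\<close>, that is \<open>T powr (3 / 2) / R\<close>. Derivatives are avoided by the
  Chapman-Robbins inequality between consecutive points of a grid of mesh \<open>\<Theta> / T\<close>. The
  change of measure takes place on the reward table: the decisions given the table do not depend
  on \<open>\<theta>\<close>, and only \<open>T\<close> rewards of the second arm can be read.
\<close>

subsection \<open>The law of the actions given the reward table\<close>

text \<open>Once the table is fixed, the arms determine the rewards. Histories can thus be replaced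
  by lists of arms, of which there are finitely many of each length, and laws become finite
  sums.\<close>

definition run :: "(nat \<times> nat \<Rightarrow> real) \<Rightarrow> nat list \<Rightarrow> history" where
  "run X as = map (\<lambda>s. (as ! s, X (as ! s, count_list (take s as) (as ! s)))) [0..<length as]"

lemma length_run [simp]: "length (run X as) = length as"
  by (simp add: run_def)

lemma map_fst_run [simp]: "map fst (run X as) = as"
  by (simp add: run_def o_def map_nth)

lemma run_Nil [simp]: "run X [] = []"
  by (simp add: run_def)

lemma run_snoc: "run X (as @ [a]) = run X as @ [(a, X (a, count_list as a))]"
  by (simp add: run_def nth_append)

text \<open>An arm has at most \<open>s\<close> pulls before the round with index \<open>s\<close>,
  so only columns below \<open>length as\<close> are read.\<close>

lemma run_cong:
  assumes "\<And>i s. i \<in> set as \<Longrightarrow> s < length as \<Longrightarrow> X (i, s) = Y (i, s)"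
  shows "run X as = run Y as"
  unfolding run_def
proof (intro map_cong refl, clarsimp)
  fix s assume s: "s < length as"
  have "count_list (take s as) (as ! s) \<le> length (take s as)"
    by (rule count_le_length)
  with s show "X (as ! s, count_list (take s as) (as ! s)) = Y (as ! s, count_list (take s as) (as ! s))"
    by (intro assms) auto
qed

primrec arms_pmf :: "(history \<Rightarrow> nat pmf) \<Rightarrow> (nat \<times> nat \<Rightarrow> real) \<Rightarrow> nat \<Rightarrow> nat list pmf" where
  "arms_pmf \<pi> X 0 = return_pmf []"
| "arms_pmf \<pi> X (Suc t) =
     bind_pmf (arms_pmf \<pi> X t) (\<lambda>as. map_pmf (\<lambda>a. as @ [a]) (\<pi> (run X as)))"

lemma history_pmf_eq: "history_pmf \<pi> X t = map_pmf (run X) (arms_pmf \<pi> X t)"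
  by (induction t)
    (simp_all add: map_bind_pmf bind_map_pmf map_pmf_comp run_snoc)

lemma map_fst_history_pmf: "map_pmf (map fst) (history_pmf \<pi> X t) = arms_pmf \<pi> X t"
  by (simp add: history_pmf_eq map_pmf_comp)

text \<open>The chain rule. Appending an arm is injective, so among all shorter lists only
  \<open>as\<close> itself contributes.\<close>

lemma pmf_arms_pmf_snoc:
  "pmf (arms_pmf \<pi> X (Suc t)) (as @ [a]) = pmf (arms_pmf \<pi> X t) as * pmf (\<pi> (run X as)) a"
proof -
  have eq: "pmf (map_pmf (\<lambda>a. bs @ [a]) (\<pi> (run X bs))) (as @ [a]) =
      (if bs = as then pmf (\<pi> (run X as)) a else 0)" for bs
  proof (cases "bs = as")
    case True
    then show ?thesis
      using pmf_map_inj'[of "\<lambda>a. as @ [a]" "\<pi> (run X as)" a] by (simp add: inj_def)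
  next
    case False
    then show ?thesis
      by (auto simp: pmf_eq_0_set_pmf)
  qed
  show ?thesis
    unfolding arms_pmf.simps pmf_bind eq
    by (subst integral_measure_pmf_real[of "{as}"]) (auto split: if_splits)
qed

lemma set_arms_pmf:
  assumes "decision_rules alg" "K \<ge> 1" "t \<le> T"
  shows "set_pmf (arms_pmf (alg T K) X t) \<subseteq> {as. set as \<subseteq> {..<K} \<and> length as = t}"
  using \<open>t \<le> T\<close>
proof (induction t)
  case (Suc t)
  have "set_pmf (alg T K (run X as)) \<subseteq> {..<K}" if "set as \<subseteq> {..<K}" "length as = t" for as
  proof -
    have "fst ` set (run X as) = set as"
      by (metis map_fst_run set_map)
    then show ?thesis
      using assms(1,2) that Suc.prems unfolding decision_rules_def by (metis Suc_le_eq length_run)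
  qed
  with Suc show ?case by fastforce
qed auto

text \<open>By the chain rule the probability of \<open>as\<close> is a product of decision
  probabilities along its prefixes, and these see the table only through \<open>run\<close>. This is
  what later reduces the infinite table to a finite one.\<close>

lemma pmf_arms_pmf_cong:
  assumes "\<And>i s. i \<in> set as \<Longrightarrow> s < length as \<Longrightarrow> X (i, s) = Y (i, s)"
  shows "pmf (arms_pmf \<pi> X (length as)) as = pmf (arms_pmf \<pi> Y (length as)) as"
  using assms
proof (induction as rule: rev_induct)
  case (snoc a as)
  have "run X as = run Y as" by (rule run_cong) (use snoc.prems in auto)
  moreover have "pmf (arms_pmf \<pi> X (length as)) as = pmf (arms_pmf \<pi> Y (length as)) as"
    using snoc by auto
  ultimately show ?case
    using pmf_arms_pmf_snoc[of \<pi> X "length as" as a] pmf_arms_pmf_snoc[of \<pi> Y "length as" as a]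
    by simp
qed simp

text \<open>Induction along the chain rule, composing each decision kernel with the map from the
  table to the history. The index set \<open>J\<close> is left general to cover both the infinite
  table and its finite part.\<close>

lemma measurable_pmf_arms_pmf:
  fixes N :: "nat \<times> nat \<Rightarrow> real measure"
  assumes alg: "decision_rules alg" "K \<ge> 1"
    and N: "\<And>j. sets (N j) = sets borel" and J: "{..<K} \<times> {..<T} \<subseteq> J"
    and as: "set as \<subseteq> {..<K}" "length as \<le> T"
  shows "(\<lambda>X. pmf (arms_pmf (alg T K) X (length as)) as) \<in> borel_measurable (PiM J N)"
  using as
proof (induction as rule: rev_induct)
  case (snoc a as)
  define t where "t = length as"
  have tT: "t < T" using snoc.prems by (simp add: t_def)
  \<comment> \<open>The history as an extensional function on \<open>{..<t}\<close>, the encoding in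
    which \<open>decision_rules\<close> provides measurability.\<close>
  define h where "h X = (\<lambda>s\<in>{..<t}. (as ! s, X (as ! s, count_list (take s as) (as ! s))))"
    for X :: "nat \<times> nat \<Rightarrow> real"
  have run: "run X as = map (h X) [0..<t]" for X
    unfolding run_def h_def t_def by (rule map_cong) auto
  have [measurable]: "h \<in> PiM J N \<rightarrow>\<^sub>M (\<Pi>\<^sub>M s\<in>{..<t}. count_space {..<K} \<Otimes>\<^sub>M borel)"
    unfolding h_def
  proof (intro measurable_restrict measurable_Pair)
    fix s assume s: "s \<in> {..<t}"
    then have "as ! s < K" using snoc.prems by (auto simp: t_def subset_iff)
    then show "(\<lambda>X. as ! s) \<in> PiM J N \<rightarrow>\<^sub>M count_space {..<K}" by simp
    have "count_list (take s as) (as ! s) \<le> length (take s as)"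
      by (rule count_le_length)
    then have "(as ! s, count_list (take s as) (as ! s)) \<in> J"
      using s tT J \<open>as ! s < K\<close> by auto
    then have "(\<lambda>X. X (as ! s, count_list (take s as) (as ! s)))
        \<in> PiM J N \<rightarrow>\<^sub>M N (as ! s, count_list (take s as) (as ! s))"
      by (rule measurable_component_singleton)
    then show "(\<lambda>X. X (as ! s, count_list (take s as) (as ! s))) \<in> borel_measurable (PiM J N)"
      by (simp add: measurable_cong_sets[OF refl N])
  qed
  have "(\<lambda>h. measure_pmf (alg T K (map h [0..<t])))
      \<in> (\<Pi>\<^sub>M s\<in>{..<t}. count_space {..<K} \<Otimes>\<^sub>M borel) \<rightarrow>\<^sub>M subprob_algebra (count_space UNIV)"
    using alg tT unfolding decision_rules_def by blast
  then have "(\<lambda>X. measure_pmf (alg T K (run X as)))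
      \<in> PiM J N \<rightarrow>\<^sub>M subprob_algebra (count_space UNIV)"
    unfolding run by measurable
  then have "(\<lambda>X. measure (measure_pmf (alg T K (run X as))) {a}) \<in> borel_measurable (PiM J N)"
    unfolding measure_def
    by (intro borel_measurable_enn2real measurable_compose[OF _ measurable_emeasure_subprob_algebra]) auto
  then have [measurable]: "(\<lambda>X. pmf (alg T K (run X as)) a) \<in> borel_measurable (PiM J N)"
    by (simp add: pmf.rep_eq)
  have [measurable]: "(\<lambda>X. pmf (arms_pmf (alg T K) X t) as) \<in> borel_measurable (PiM J N)"
    using snoc by (simp add: t_def)
  show ?case
    using pmf_arms_pmf_snoc[of "alg T K" _ t as a] by (simp add: t_def[symmetric])
qed simp

section \<open>Averaging over the reward table\<close>

lemma measurable_arms_pmf: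
  fixes N :: "nat \<times> nat \<Rightarrow> real measure"
  assumes alg: "decision_rules alg" "K \<ge> 1"
    and N: "\<And>j. sets (N j) = sets borel" and J: "{..<K} \<times> {..<T} \<subseteq> J"
  shows "(\<lambda>X. measure_pmf (arms_pmf (alg T K) X T))
           \<in> PiM J N \<rightarrow>\<^sub>M subprob_algebra (count_space UNIV)"
proof (rule measurable_subprob_algebra)
  let ?L = "{as. set as \<subseteq> {..<K} \<and> length as = T}"
  have fin: "finite ?L" by (rule finite_lists_length_eq) simp
  fix A :: "nat list set"
  have "emeasure (measure_pmf (arms_pmf (alg T K) X T)) A =
      ennreal (\<Sum>as\<in>A \<inter> ?L. pmf (arms_pmf (alg T K) X T) as)" for X
  proof -
    have "emeasure (measure_pmf (arms_pmf (alg T K) X T)) A =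
        emeasure (measure_pmf (arms_pmf (alg T K) X T)) (A \<inter> ?L)"
      by (rule emeasure_eq_AE)
        (use set_arms_pmf[OF alg order_refl] in \<open>auto simp: AE_measure_pmf_iff subset_iff\<close>)
    also have "\<dots> = ennreal (\<Sum>as\<in>A \<inter> ?L. pmf (arms_pmf (alg T K) X T) as)"
      using fin by (simp add: measure_pmf.emeasure_eq_measure measure_measure_pmf_finite)
    finally show ?thesis .
  qed
  moreover have "(\<lambda>X. pmf (arms_pmf (alg T K) X T) as) \<in> borel_measurable (PiM J N)"
    if "as \<in> A \<inter> ?L" for as
    using measurable_pmf_arms_pmf[OF alg N J, of as] that by auto
  ultimately show "(\<lambda>X. emeasure (measure_pmf (arms_pmf (alg T K) X T)) A)
      \<in> borel_measurable (PiM J N)" by simp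
qed (simp_all add: measure_pmf.subprob_space_axioms)

text \<open>Prepares the change of measure: the reward laws enter only through a finite product
  measure, while the weights of the action lists depend on the algorithm and the table
  alone.\<close>

lemma integral_action_law:
  fixes F :: "nat list \<Rightarrow> real"
  assumes alg: "decision_rules alg" and K: "length \<nu> = K" "K \<ge> 1"
    and \<nu>: "\<And>\<mu>. \<mu> \<in> set \<nu> \<Longrightarrow> prob_space \<mu>" "\<And>\<mu>. \<mu> \<in> set \<nu> \<Longrightarrow> sets \<mu> = sets borel"
  shows "(\<integral>as. F as \<partial>action_law alg \<nu> T) =
    (\<integral>X. (\<Sum>as | set as \<subseteq> {..<K} \<and> length as = T. F as * pmf (arms_pmf (alg T K) X T) as)
      \<partial>(\<Pi>\<^sub>M (i, s)\<in>{..<K} \<times> {..<T}. \<nu> ! i))"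
proof -
  let ?L = "{as. set as \<subseteq> {..<K} \<and> length as = T}"
  have fin: "finite ?L" by (rule finite_lists_length_eq) simp
  \<comment> \<open>Indices that belong to no arm get a point mass, so that every index carries a
    probability measure.\<close>
  define N where "N = (\<lambda>(i, s::nat). if i < K then \<nu> ! i else return borel 0)"
  have N: "prob_space (N j)" "sets (N j) = sets borel" for j
    using \<nu> K by (auto simp: N_def prob_space_return split: prod.split)
  let ?I = "{..<K} \<times> (UNIV :: nat set)" and ?J = "{..<K} \<times> {..<T}"
  have PI: "reward_table \<nu> = PiM ?I N"
    unfolding reward_table_def K N_def by (rule PiM_cong) auto
  have PJ: "(\<Pi>\<^sub>M (i, s)\<in>?J. \<nu> ! i) = PiM ?J N"
    unfolding N_def by (rule PiM_cong) auto
  interpret product_prob_space N ?I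
    by (intro product_prob_spaceI N)
  have I: "prob_space (PiM ?I N)"
    by (intro prob_space_PiM N)
  let ?G = "\<lambda>X. \<Sum>as\<in>?L. F as * pmf (arms_pmf (alg T K) X T) as"
  have mG: "?G \<in> borel_measurable (PiM ?J N)"
  proof (intro borel_measurable_sum borel_measurable_times)
    fix as assume "as \<in> ?L"
    then show "(\<lambda>X. pmf (arms_pmf (alg T K) X T) as) \<in> borel_measurable (PiM ?J N)"
      using measurable_pmf_arms_pmf[OF alg K(2) N(2), of T ?J as] by auto
  qed simp
  have cong: "?G (restrict X ?J) = ?G X" for X
  proof (intro sum.cong arg_cong2[where f = "(*)"] refl)
    fix as assume "as \<in> ?L"
    then have as: "set as \<subseteq> {..<K}" "length as = T" by auto
    have *: "restrict X ?J (i, s) = X (i, s)" if "i \<in> set as" "s < length as" for i s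
      using that as by auto
    show "pmf (arms_pmf (alg T K) (restrict X ?J) T) as = pmf (arms_pmf (alg T K) X T) as"
      using pmf_arms_pmf_cong[of as "restrict X ?J" X "alg T K", OF *] as(2) by simp
  qed
  let ?B = "PiM ?I N \<bind> (\<lambda>X. measure_pmf (arms_pmf (alg T K) X T))"
  \<comment> \<open>\<open>F\<close> may be unbounded on arbitrary lists. Its truncation to
    \<open>?L\<close> is bounded and almost surely equal to it, so the integral over the bind can be
    computed as an iterated one.\<close>
  define F' where "F' as = (if as \<in> ?L then F as else 0)" for as
  have mA: "(\<lambda>X. measure_pmf (arms_pmf (alg T K) X T)) \<in> PiM ?I N \<rightarrow>\<^sub>M subprob_algebra (count_space UNIV)"
    by (rule measurable_arms_pmf[OF alg K(2) N(2)]) auto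
  have sB: "sets ?B = sets (count_space UNIV)"
    by (rule sets_bind[OF _ prob_space.not_empty[OF I]]) simp
  have inL: "AE as in ?B. as \<in> ?L"
    using set_arms_pmf[OF alg K(2) order_refl, of T]
    by (subst AE_bind[OF mA]) (simp_all add: AE_measure_pmf_iff subset_iff)
  have "(\<integral>as. F as \<partial>action_law alg \<nu> T) = (\<integral>as. F as \<partial>?B)"
    by (simp add: action_law_def map_fst_history_pmf K PI)
  also have "\<dots> = (\<integral>as. F' as \<partial>?B)"
  proof (rule integral_cong_AE)
    show "AE as in ?B. F as = F' as"
      using inL by eventually_elim (simp add: F'_def)
  qed (simp_all add: measurable_cong_sets[OF sB refl])
  also have "\<dots> = (\<integral>X. (\<integral>as. F' as \<partial>measure_pmf (arms_pmf (alg T K) X T)) \<partial>PiM ?I N)"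
  proof (rule integral_bind[OF _ _ mA, where B' = 1])
    fix as
    show "\<bar>F' as\<bar> \<le> (\<Sum>as\<in>?L. \<bar>F as\<bar>)"
      using fin member_le_sum[of as ?L "\<lambda>as. \<bar>F as\<bar>"] by (auto simp: F'_def intro: sum_nonneg)
  qed (auto simp: measure_pmf.emeasure_eq_measure intro: prob_space.finite_measure[OF I])
  also have "\<dots> = (\<integral>X. (\<Sum>as\<in>?L. F' as * pmf (arms_pmf (alg T K) X T) as) \<partial>PiM ?I N)"
    by (intro Bochner_Integration.integral_cong refl integral_measure_pmf_real fin)
      (auto simp: F'_def split: if_splits)
  also have "\<dots> = (\<integral>X. ?G X \<partial>PiM ?I N)"
    by (intro Bochner_Integration.integral_cong sum.cong refl) (simp add: F'_def)
  \<comment> \<open>Since \<open>?G\<close> reads only cells in \<open>?J\<close>, the infinite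
    product can be replaced by its marginal on \<open>?J\<close>.\<close>
  also have "\<dots> = (\<integral>X. ?G (restrict X ?J) \<partial>PiM ?I N)"
    by (simp only: cong)
  also have "\<dots> = (\<integral>X. ?G X \<partial>distr (PiM ?I N) (PiM ?J N) (\<lambda>X. restrict X ?J))"
    by (rule integral_distr[symmetric, OF _ mG]) (rule measurable_restrict_subset, auto)
  also have "distr (PiM ?I N) (PiM ?J N) (\<lambda>X. restrict X ?J) = PiM ?J N"
    by (rule distr_PiM_restrict_finite) auto
  finally show ?thesis by (simp only: PJ)
qed

lemma sum_pmf_arms_pmf:
  assumes "decision_rules alg" "K \<ge> 1"
  shows "(\<Sum>as | set as \<subseteq> {..<K} \<and> length as = T. pmf (arms_pmf (alg T K) X T) as) = 1"
  using assms by (intro sum_pmf_eq_1 set_arms_pmf finite_lists_length_eq) auto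

text \<open>The counts of all arms add up to \<open>T\<close> in each single action list, before any
  averaging.\<close>

lemma sum_expected_pulls:
  assumes alg: "decision_rules alg" and K: "length \<nu> = K" "K \<ge> 1"
    and \<nu>: "\<And>\<mu>. \<mu> \<in> set \<nu> \<Longrightarrow> prob_space \<mu>" "\<And>\<mu>. \<mu> \<in> set \<nu> \<Longrightarrow> sets \<mu> = sets borel"
  shows "(\<Sum>i<K. expected_pulls alg \<nu> T i) = real T"
proof -
  let ?L = "{as. set as \<subseteq> {..<K} \<and> length as = T}"
  define N where "N = (\<lambda>(i, s::nat). if i < K then \<nu> ! i else return borel 0)"
  have N: "prob_space (N j)" "sets (N j) = sets borel" for j
    using \<nu> K by (auto simp: N_def prob_space_return split: prod.split)
  let ?J = "{..<K} \<times> {..<T}"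
  let ?w = "\<lambda>X. pmf (arms_pmf (alg T K) X T)"
  have PJ: "(\<Pi>\<^sub>M (i, s)\<in>?J. \<nu> ! i) = PiM ?J N"
    unfolding N_def by (rule PiM_cong) auto
  interpret P: prob_space "PiM ?J N" by (intro prob_space_PiM N)
  have int: "integrable (PiM ?J N) (\<lambda>X. ?w X as)" if "as \<in> ?L" for as
    using measurable_pmf_arms_pmf[OF alg K(2) N(2), of T ?J as] that
    by (intro P.integrable_const_bound[of _ 1]) (auto simp: pmf_le_1)
  have "(\<Sum>i<K. expected_pulls alg \<nu> T i) =
      (\<Sum>i<K. \<integral>X. (\<Sum>as\<in>?L. num_pulls i as * ?w X as) \<partial>PiM ?J N)"
    unfolding expected_pulls_def by (simp add: integral_action_law[OF alg K \<nu>] PJ)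
  also have "\<dots> = (\<integral>X. (\<Sum>i<K. \<Sum>as\<in>?L. num_pulls i as * ?w X as) \<partial>PiM ?J N)"
    using int by (intro Bochner_Integration.integral_sum[symmetric] Bochner_Integration.integrable_sum) auto
  also have "\<dots> = (\<integral>X. real T \<partial>PiM ?J N)"
  proof (intro Bochner_Integration.integral_cong refl)
    fix X
    have "(\<Sum>i<K. \<Sum>as\<in>?L. num_pulls i as * ?w X as) = (\<Sum>as\<in>?L. (\<Sum>i<K. num_pulls i as) * ?w X as)"
      by (subst sum.swap) (simp add: sum_distrib_right)
    also have "\<dots> = (\<Sum>as\<in>?L. real T * ?w X as)"
      by (intro sum.cong refl) (auto simp: num_pulls_def sum_count_set simp flip: of_nat_sum)
    also have "\<dots> = real T"
      using sum_pmf_arms_pmf[OF alg K(2), of T X] by (simp flip: sum_distrib_left)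
    finally show "(\<Sum>i<K. \<Sum>as\<in>?L. num_pulls i as * ?w X as) = real T" .
  qed
  also have "\<dots> = real T" using P.prob_space by simp
  finally show ?thesis .
qed

subsection \<open>The Chapman-Robbins inequality\<close>

text \<open>The integral of \<open>(f x + c * g x)\<^sup>2\<close> is a nonnegative quadratic in
  \<open>c\<close>; its value at the minimiser \<open>- ?B / ?C\<close> gives the bound. If
  \<open>?C = 0\<close> it is affine in \<open>c\<close>, and nonnegativity everywhere forces
  \<open>?B = 0\<close>.\<close>

lemma Cauchy_Schwarz_integral:
  fixes f g :: "'a \<Rightarrow> real"
  assumes [measurable]: "f \<in> borel_measurable M" "g \<in> borel_measurable M"
    and f: "integrable M (\<lambda>x. (f x)\<^sup>2)" and g: "integrable M (\<lambda>x. (g x)\<^sup>2)"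
  shows "(\<integral>x. f x * g x \<partial>M)\<^sup>2 \<le> (\<integral>x. (f x)\<^sup>2 \<partial>M) * (\<integral>x. (g x)\<^sup>2 \<partial>M)"
proof -
  have fg: "integrable M (\<lambda>x. f x * g x)"
  proof (rule Bochner_Integration.integrable_bound)
    show "integrable M (\<lambda>x. (f x)\<^sup>2 + (g x)\<^sup>2)" using f g by simp
    have "norm (f x * g x) \<le> norm ((f x)\<^sup>2 + (g x)\<^sup>2)" for x
      using zero_le_power2[of "\<bar>f x\<bar> - \<bar>g x\<bar>"] mult_nonneg_nonneg[of "\<bar>f x\<bar>" "\<bar>g x\<bar>"]
      unfolding real_norm_def abs_mult power2_diff power2_abs by linarith
    then show "AE x in M. norm (f x * g x) \<le> norm ((f x)\<^sup>2 + (g x)\<^sup>2)" by simp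
  qed measurable
  let ?A = "\<integral>x. (f x)\<^sup>2 \<partial>M" and ?B = "\<integral>x. f x * g x \<partial>M" and ?C = "\<integral>x. (g x)\<^sup>2 \<partial>M"
  have quad: "0 \<le> ?A + 2 * c * ?B + c\<^sup>2 * ?C" for c :: real
  proof -
    have "0 \<le> (\<integral>x. (f x + c * g x)\<^sup>2 \<partial>M)" by simp
    also have "\<dots> = (\<integral>x. ((f x)\<^sup>2 + 2 * c * (f x * g x)) + c\<^sup>2 * (g x)\<^sup>2 \<partial>M)"
      by (simp add: power2_sum power_mult_distrib algebra_simps)
    also have "\<dots> = ?A + 2 * c * ?B + c\<^sup>2 * ?C"
      using f g fg by (simp del: mult.assoc)
    finally show ?thesis .
  qed
  show ?thesis
  proof (cases "?C = 0")
    case True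
    then have *: "0 \<le> ?A + 2 * c * ?B" for c using quad[of c] by simp
    have "?B = 0"
    proof (rule ccontr)
      assume "?B \<noteq> 0"
      then show False using *[of "- (?A + 1) / (2 * ?B)"] by (simp add: field_simps)
    qed
    then show ?thesis by simp
  next
    case False
    moreover have "?C \<ge> 0" by simp
    ultimately have C: "?C > 0" by linarith
    have "0 \<le> ?A + 2 * (- ?B / ?C) * ?B + (- ?B / ?C)\<^sup>2 * ?C" by (rule quad)
    also have "\<dots> = ?A - ?B\<^sup>2 / ?C"
      using C by (simp add: power2_eq_square field_simps)
    finally show ?thesis using C by (simp add: field_simps)
  qed
qed

text \<open>A version for randomised statistics: \<open>w x y\<close> is the probability of the
  outcome \<open>y\<close> given the data \<open>x\<close>, the same under both measures. The shift
  of the mean is the covariance of \<open>h\<close> with the conditional mean of \<open>F\<close>;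
  Cauchy-Schwarz bounds it by the chi-square divergence times a variance.\<close>

lemma Chapman_Robbins:
  fixes F :: "'b \<Rightarrow> real" and w :: "'a \<Rightarrow> 'b \<Rightarrow> real"
  assumes P: "prob_space P" and Q: "prob_space (density P (\<lambda>x. ennreal (h x)))"
    and h [measurable]: "h \<in> borel_measurable P" and h0: "\<And>x. h x \<ge> 0"
    and h2: "integrable P (\<lambda>x. (h x)\<^sup>2)"
    and L: "finite L"
    and w [measurable]: "\<And>y. y \<in> L \<Longrightarrow> (\<lambda>x. w x y) \<in> borel_measurable P"
    and w0: "\<And>x y. w x y \<ge> 0" and w1: "\<And>x. (\<Sum>y\<in>L. w x y) = 1"
  defines "m \<equiv> \<integral>x. (\<Sum>y\<in>L. F y * w x y) \<partial>P"
  shows "((\<integral>x. (\<Sum>y\<in>L. F y * w x y) \<partial>density P (\<lambda>x. ennreal (h x))) - m)\<^sup>2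
    \<le> ((\<integral>x. (h x)\<^sup>2 \<partial>P) - 1) * (\<integral>x. (\<Sum>y\<in>L. (F y - m)\<^sup>2 * w x y) \<partial>P)"
proof -
  interpret P: prob_space P by (rule P)
  interpret Q: prob_space "density P (\<lambda>x. ennreal (h x))" by (rule Q)
  have wle: "w x y \<le> 1" if "y \<in> L" for x y
    using member_le_sum[of y L "w x"] that w0 w1 L by simp
  have bound: "\<bar>\<Sum>y\<in>L. f y * w x y\<bar> \<le> (\<Sum>y\<in>L. \<bar>f y\<bar>)" for f :: "'b \<Rightarrow> real" and x
    by (rule order.trans[OF sum_abs sum_mono])
      (use w0 wle in \<open>simp add: abs_mult mult_left_le\<close>)
  have meas [measurable]: "(\<lambda>x. \<Sum>y\<in>L. f y * w x y) \<in> borel_measurable P" for f :: "'b \<Rightarrow> real"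
    by (intro borel_measurable_sum borel_measurable_times w) auto
  have intP: "integrable P (\<lambda>x. \<Sum>y\<in>L. f y * w x y)" for f :: "'b \<Rightarrow> real"
    by (rule P.integrable_const_bound[of _ "\<Sum>y\<in>L. \<bar>f y\<bar>"]) (simp_all add: bound)
  have intQ: "integrable (density P (\<lambda>x. ennreal (h x))) (\<lambda>x. \<Sum>y\<in>L. f y * w x y)"
    for f :: "'b \<Rightarrow> real"
    by (rule Q.integrable_const_bound[of _ "\<Sum>y\<in>L. \<bar>f y\<bar>"]) (simp_all add: bound)
  \<comment> \<open>The conditional expectation of \<open>F\<close> given \<open>x\<close>, centred
    under \<open>P\<close>.\<close>
  define Y where "Y x = (\<Sum>y\<in>L. (F y - m) * w x y)" for x
  have Y: "Y x = (\<Sum>y\<in>L. F y * w x y) - m" for x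
    by (simp add: Y_def left_diff_distrib sum_subtractf w1 flip: sum_distrib_left)
  have [measurable]: "Y \<in> borel_measurable P" unfolding Y_def by measurable
  have intY: "integrable P Y" unfolding Y_def by (rule intP)
  have Yb: "\<bar>Y x\<bar> \<le> (\<Sum>y\<in>L. \<bar>F y - m\<bar>)" for x unfolding Y_def by (rule bound)
  have "norm ((Y x)\<^sup>2) \<le> (\<Sum>y\<in>L. \<bar>F y - m\<bar>)\<^sup>2" for x
    using power_mono[OF Yb abs_ge_zero, of x 2] by simp
  then have intY2: "integrable P (\<lambda>x. (Y x)\<^sup>2)"
    by (intro P.integrable_const_bound[of _ "(\<Sum>y\<in>L. \<bar>F y - m\<bar>)\<^sup>2"]) simp_all
  have inth: "integrable P h"
    using h h2 by (rule P.square_integrable_imp_integrable)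
  have inthY: "integrable P (\<lambda>x. h x * Y x)"
  proof -
    have "integrable (density P (\<lambda>x. ennreal (h x))) Y"
      unfolding Y_def by (rule intQ)
    then show ?thesis using h0 by (subst (asm) integrable_real_density) auto
  qed
  have EY: "(\<integral>x. Y x \<partial>P) = 0"
    unfolding Y using intP[of F] by (simp add: P.prob_space m_def)
  have Eh: "(\<integral>x. h x \<partial>P) = 1"
  proof -
    have "(\<integral>x. 1 \<partial>density P (\<lambda>x. ennreal (h x))) = (\<integral>x. h x \<partial>P)"
      using h0 by (subst integral_real_density) auto
    then show ?thesis using Q.prob_space by simp
  qed
  have "(\<integral>x. (\<Sum>y\<in>L. F y * w x y) \<partial>density P (\<lambda>x. ennreal (h x))) - m
      = (\<integral>x. Y x \<partial>density P (\<lambda>x. ennreal (h x)))"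
    unfolding Y using intQ[of F] Q.prob_space by simp
  also have "\<dots> = (\<integral>x. h x * Y x \<partial>P)"
    using h0 by (subst integral_real_density) auto
  \<comment> \<open>Subtracting 1 from \<open>h\<close> is free because \<open>Y\<close> has mean 0
    under \<open>P\<close>.\<close>
  also have "\<dots> = (\<integral>x. (h x - 1) * Y x \<partial>P)"
    using inthY intY EY by (simp add: left_diff_distrib)
  finally have eq: "(\<integral>x. (\<Sum>y\<in>L. F y * w x y) \<partial>density P (\<lambda>x. ennreal (h x))) - m
      = (\<integral>x. (h x - 1) * Y x \<partial>P)" .
  have h1: "(h x - 1)\<^sup>2 = ((h x)\<^sup>2 - 2 * h x) + 1" for x by (simp add: power2_diff)
  have inth1: "integrable P (\<lambda>x. (h x - 1)\<^sup>2)"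
    unfolding h1 using h2 inth by simp
  have Eh1: "(\<integral>x. (h x - 1)\<^sup>2 \<partial>P) = (\<integral>x. (h x)\<^sup>2 \<partial>P) - 1"
    unfolding h1 using h2 inth Eh by (simp add: P.prob_space)
  \<comment> \<open>Jensen's inequality for the weights \<open>w x\<close>, obtained by splitting
    each weight into two square roots.\<close>
  have Y2: "(Y x)\<^sup>2 \<le> (\<Sum>y\<in>L. (F y - m)\<^sup>2 * w x y)" for x
  proof -
    have "(Y x)\<^sup>2 = (\<Sum>y\<in>L. ((F y - m) * sqrt (w x y)) * sqrt (w x y))\<^sup>2"
      unfolding Y_def using w0 by (simp add: mult.assoc)
    also have "\<dots> \<le> (\<Sum>y\<in>L. ((F y - m) * sqrt (w x y))\<^sup>2) * (\<Sum>y\<in>L. (sqrt (w x y))\<^sup>2)"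
      by (rule Cauchy_Schwarz_ineq_sum)
    also have "\<dots> = (\<Sum>y\<in>L. (F y - m)\<^sup>2 * w x y)"
      using w0 w1 by (simp add: power_mult_distrib)
    finally show ?thesis .
  qed
  have "(\<integral>x. (h x - 1) * Y x \<partial>P)\<^sup>2 \<le> (\<integral>x. (h x - 1)\<^sup>2 \<partial>P) * (\<integral>x. (Y x)\<^sup>2 \<partial>P)"
    by (rule Cauchy_Schwarz_integral) (use inth1 intY2 in auto)
  also have "\<dots> \<le> (\<integral>x. (h x - 1)\<^sup>2 \<partial>P) * (\<integral>x. (\<Sum>y\<in>L. (F y - m)\<^sup>2 * w x y) \<partial>P)"
    by (intro mult_left_mono integral_mono intY2 intP Y2) simp
  finally show ?thesis by (simp only: eq Eh1)
qed

section \<open>Change of measure on finite products\<close>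

text \<open>Boxes determine a product measure, and on a box the integral of the product density
  factorises by independence.\<close>

lemma PiM_density:
  assumes J: "finite J"
    and N: "\<And>j. prob_space (N j)" and N': "\<And>j. prob_space (N' j)"
    and f: "\<And>j. j \<in> J \<Longrightarrow> f j \<in> borel_measurable (N j)"
    and eq: "\<And>j. j \<in> J \<Longrightarrow> N' j = density (N j) (f j)"
  shows "PiM J N' = density (PiM J N) (\<lambda>x. \<Prod>j\<in>J. f j (x j))"
proof -
  interpret N: product_prob_space N J by (intro product_prob_spaceI N)
  interpret N': product_prob_space N' J by (intro product_prob_spaceI N')
  have sets: "sets (N' j) = sets (N j)" if "j \<in> J" for j using eq[OF that] by simp
  have m: "(\<lambda>x. \<Prod>j\<in>J. f j (x j)) \<in> borel_measurable (PiM J N)"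
  proof (rule borel_measurable_prod_ennreal)
    fix j assume "j \<in> J"
    then show "(\<lambda>x. f j (x j)) \<in> borel_measurable (PiM J N)"
      by (intro measurable_compose[where f = "\<lambda>x. x j" and g = "f j", OF _ f] measurable_component_singleton)
  qed
  have "density (PiM J N) (\<lambda>x. \<Prod>j\<in>J. f j (x j)) = PiM J N'"
  proof (rule N'.PiM_eqI[OF J])
    show "sets (density (PiM J N) (\<lambda>x. \<Prod>j\<in>J. f j (x j))) = sets (PiM J N')"
      using sets by (simp cong: sets_PiM_cong)
    fix A assume "\<And>j. j \<in> J \<Longrightarrow> A j \<in> sets (N' j)"
    then have A: "A j \<in> sets (N j)" if "j \<in> J" for j using sets that by simp
    have "emeasure (density (PiM J N) (\<lambda>x. \<Prod>j\<in>J. f j (x j))) (Pi\<^sub>E J A) =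
        (\<integral>\<^sup>+x. (\<Prod>j\<in>J. f j (x j)) * indicator (Pi\<^sub>E J A) x \<partial>PiM J N)"
      using A by (intro emeasure_density m sets_PiM_I_finite J) auto
    also have "\<dots> = (\<integral>\<^sup>+x. (\<Prod>j\<in>J. f j (x j) * indicator (A j) (x j)) \<partial>PiM J N)"
    proof (rule nn_integral_cong)
      \<comment> \<open>Points of the space are extensional, so lying in the box means exactly that
        every coordinate \<open>x j\<close> lies in \<open>A j\<close>.\<close>
      fix x assume "x \<in> space (PiM J N)"
      then have "x \<in> extensional J" by (simp add: space_PiM PiE_def)
      then show "(\<Prod>j\<in>J. f j (x j)) * indicator (Pi\<^sub>E J A) x =
          (\<Prod>j\<in>J. f j (x j) * indicator (A j) (x j))"
        using J by (auto simp: prod.distrib indicator_def PiE_iff prod_zero_iff)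
    qed
    also have "\<dots> = (\<Prod>j\<in>J. \<integral>\<^sup>+x. f j x * indicator (A j) x \<partial>N j)"
      using A f by (intro N.product_nn_integral_prod J) auto
    also have "\<dots> = (\<Prod>j\<in>J. emeasure (N' j) (A j))"
      using A f eq by (intro prod.cong) (simp_all add: emeasure_density)
    finally show "emeasure (density (PiM J N) (\<lambda>x. \<Prod>j\<in>J. f j (x j))) (Pi\<^sub>E J A) =
      (\<Prod>j\<in>J. emeasure (N' j) (A j))" .
  qed
  then show ?thesis by simp
qed

subsection \<open>Two-point reward laws\<close>

text \<open>The success probability makes the mean \<open>a * \<theta>\<close> for
  \<open>\<bar>\<theta>\<bar> \<le> 1\<close>: linear in the parameter, with \<open>a\<close> as
  scale.\<close>

definition two_point :: "real \<Rightarrow> real \<Rightarrow> real measure" where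
  "two_point a \<theta> = distr (measure_pmf (bernoulli_pmf ((1 + \<theta>) / 2))) borel (\<lambda>b. if b then a else - a)"

lemma prob_space_two_point: "prob_space (two_point a \<theta>)"
  unfolding two_point_def by (rule measure_pmf.prob_space_distr) simp

lemma sets_two_point [simp, measurable_cong]: "sets (two_point a \<theta>) = sets borel"
  by (simp add: two_point_def)

lemma integrable_two_point:
  fixes f :: "real \<Rightarrow> real"
  assumes [measurable]: "f \<in> borel_measurable borel"
  shows "integrable (two_point a \<theta>) f"
  unfolding two_point_def by (subst integrable_distr_eq) (auto intro!: integrable_measure_pmf_finite)

lemma integral_two_point:
  fixes f :: "real \<Rightarrow> real"
  assumes [measurable]: "f \<in> borel_measurable borel" and "\<bar>\<theta>\<bar> \<le> 1"
  shows "(\<integral>x. f x \<partial>two_point a \<theta>) = (1 + \<theta>) / 2 * f a + (1 - \<theta>) / 2 * f (- a)"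
proof -
  have "(\<integral>x. f x \<partial>two_point a \<theta>) =
      (\<integral>b. f (if b then a else - a) \<partial>bernoulli_pmf ((1 + \<theta>) / 2))"
    unfolding two_point_def by (rule integral_distr) auto
  also have "\<dots> = (1 + \<theta>) / 2 * f a + (1 - \<theta>) / 2 * f (- a)"
    using assms(2) by (subst integral_bernoulli_pmf) (auto simp: field_simps)
  finally show ?thesis .
qed

lemma nn_integral_two_point:
  assumes [measurable]: "f \<in> borel_measurable borel" and "\<bar>\<theta>\<bar> \<le> 1"
  shows "(\<integral>\<^sup>+x. f x \<partial>two_point a \<theta>) = f a * ennreal ((1 + \<theta>) / 2) + f (- a) * ennreal ((1 - \<theta>) / 2)"
proof -
  have "(\<integral>\<^sup>+x. f x \<partial>two_point a \<theta>) =
      (\<integral>\<^sup>+b. f (if b then a else - a) \<partial>bernoulli_pmf ((1 + \<theta>) / 2))"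
    unfolding two_point_def by (rule nn_integral_distr) auto
  also have "\<dots> = f a * ennreal ((1 + \<theta>) / 2) + f (- a) * ennreal (1 - (1 + \<theta>) / 2)"
    using assms(2) by (subst nn_integral_bernoulli_pmf) auto
  also have "1 - (1 + \<theta>) / 2 = (1 - \<theta>) / 2" by (simp add: field_simps)
  finally show ?thesis .
qed

lemma mean_two_point: "\<bar>\<theta>\<bar> \<le> 1 \<Longrightarrow> mean (two_point a \<theta>) = a * \<theta>"
  unfolding mean_def by (subst integral_two_point) (auto simp: field_simps)

text \<open>Hoeffding's lemma on an interval of width \<open>2 * a\<close>; that lemma requires a
  positive exponent.\<close>

lemma mgf_two_point_pos:
  assumes a: "0 < a" and \<theta>: "\<bar>\<theta>\<bar> \<le> 1" and l: "l > 0"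
  shows "(\<integral>x. exp (l * (x - mean (two_point a \<theta>))) \<partial>two_point a \<theta>) \<le> exp (l\<^sup>2 * a\<^sup>2 / 2)"
proof -
  interpret prob_space "two_point a \<theta>" by (rule prob_space_two_point)
  interpret interval_bounded_random_variable "two_point a \<theta>" "\<lambda>x. x" "- a" a
  proof
    show "AE x in two_point a \<theta>. x \<in> {- a..a}"
      unfolding two_point_def using a by (subst AE_distr_iff) (auto simp: AE_measure_pmf_iff)
  qed simp
  have "ennreal (\<integral>x. exp (l * (x - mean (two_point a \<theta>))) \<partial>two_point a \<theta>) =
      (\<integral>\<^sup>+x. exp (l * (x - mean (two_point a \<theta>))) \<partial>two_point a \<theta>)"
    by (rule nn_integral_eq_integral[symmetric]) (auto intro: integrable_two_point)
  also have "\<dots> \<le> ennreal (exp (l\<^sup>2 * (a - - a)\<^sup>2 / 8))"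
    unfolding mean_def by (rule Hoeffdings_lemma_nn_integral[OF l])
  also have "l\<^sup>2 * (a - - a)\<^sup>2 / 8 = l\<^sup>2 * a\<^sup>2 / 2"
    by (simp add: power2_eq_square)
  finally show ?thesis by simp
qed

text \<open>
  Negative exponents reduce to positive ones because reflecting the law negates the parameter.
\<close>

lemma sub_gaussian_two_point:
  assumes a: "0 < a" "a \<le> \<sigma>" and \<theta>: "\<bar>\<theta>\<bar> \<le> 1"
  shows "sub_gaussian \<sigma> (two_point a \<theta>)"
  unfolding sub_gaussian_def
proof (intro allI conjI)
  fix l :: real
  show "integrable (two_point a \<theta>) (\<lambda>x. exp (l * (x - mean (two_point a \<theta>))))"
    by (rule integrable_two_point) simp
  have "(\<integral>x. exp (l * (x - mean (two_point a \<theta>))) \<partial>two_point a \<theta>) \<le> exp (l\<^sup>2 * a\<^sup>2 / 2)"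
  proof (cases l "0 :: real" rule: linorder_cases)
    case less
    have "(\<integral>x. exp (l * (x - mean (two_point a \<theta>))) \<partial>two_point a \<theta>) =
        (\<integral>x. exp (- l * (x - mean (two_point a (- \<theta>)))) \<partial>two_point a (- \<theta>))"
    proof -
      have "l * (a - a * \<theta>) = - l * (- a - a * - \<theta>)" "l * (- a - a * \<theta>) = - l * (a - a * - \<theta>)"
        by (simp_all add: algebra_simps)
      then show ?thesis
        using \<theta> by (simp add: integral_two_point mean_two_point)
    qed
    also have "\<dots> \<le> exp ((- l)\<^sup>2 * a\<^sup>2 / 2)"
      by (rule mgf_two_point_pos) (use a \<theta> less in auto)
    finally show ?thesis by simp
  next
    case equal
    then show ?thesis
      using prob_space.prob_space[OF prob_space_two_point] by simp
  next
    case greater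
    then show ?thesis using mgf_two_point_pos a \<theta> by blast
  qed
  also have "\<dots> \<le> exp (l\<^sup>2 * \<sigma>\<^sup>2 / 2)"
    using a by (simp add: mult_left_mono power_mono)
  finally show "(\<integral>x. exp (l * (x - mean (two_point a \<theta>))) \<partial>two_point a \<theta>) \<le> exp (l\<^sup>2 * \<sigma>\<^sup>2 / 2)" .
qed

section \<open>Likelihood ratios of two-point laws\<close>

text \<open>The sign of \<open>x\<close> tells the two atoms apart, so the formula is independent of
  the scale \<open>a\<close>.\<close>

definition likelihood_ratio :: "real \<Rightarrow> real \<Rightarrow> real \<Rightarrow> real" where
  "likelihood_ratio \<theta> \<theta>' x = (if x > 0 then (1 + \<theta>') / (1 + \<theta>) else (1 - \<theta>') / (1 - \<theta>))"

lemma borel_measurable_likelihood_ratio [measurable]: "likelihood_ratio \<theta> \<theta>' \<in> borel_measurable borel"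
  unfolding likelihood_ratio_def by measurable

lemma likelihood_ratio_nonneg: "\<bar>\<theta>\<bar> < 1 \<Longrightarrow> \<bar>\<theta>'\<bar> \<le> 1 \<Longrightarrow> likelihood_ratio \<theta> \<theta>' x \<ge> 0"
  by (auto simp: likelihood_ratio_def)

lemma two_point_density:
  assumes a: "a > 0" and \<theta>: "\<bar>\<theta>\<bar> < 1" "\<bar>\<theta>'\<bar> \<le> 1"
  shows "two_point a \<theta>' = density (two_point a \<theta>) (\<lambda>x. ennreal (likelihood_ratio \<theta> \<theta>' x))"
proof (rule measure_eqI)
  fix A assume "A \<in> sets (two_point a \<theta>')"
  then have [measurable]: "A \<in> sets borel" by simp
  have "emeasure (two_point a \<theta>') A = (\<integral>\<^sup>+x. indicator A x \<partial>two_point a \<theta>')"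
    by simp
  also have "\<dots> = indicator A a * ennreal ((1 + \<theta>') / 2) + indicator A (- a) * ennreal ((1 - \<theta>') / 2)"
    by (rule nn_integral_two_point) (use \<theta> in auto)
  also have "\<dots> = ennreal (likelihood_ratio \<theta> \<theta>' a) * indicator A a * ennreal ((1 + \<theta>) / 2) +
      ennreal (likelihood_ratio \<theta> \<theta>' (- a)) * indicator A (- a) * ennreal ((1 - \<theta>) / 2)"
  proof -
    have r: "likelihood_ratio \<theta> \<theta>' a * ((1 + \<theta>) / 2) = (1 + \<theta>') / 2"
      "likelihood_ratio \<theta> \<theta>' (- a) * ((1 - \<theta>) / 2) = (1 - \<theta>') / 2"
      using a \<theta> by (auto simp: likelihood_ratio_def)
    have *: "ennreal (likelihood_ratio \<theta> \<theta>' a) * ennreal ((1 + \<theta>) / 2) = ennreal ((1 + \<theta>') / 2)"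
      "ennreal (likelihood_ratio \<theta> \<theta>' (- a)) * ennreal ((1 - \<theta>) / 2) = ennreal ((1 - \<theta>') / 2)"
      unfolding r[symmetric] by (rule ennreal_mult[symmetric]; use \<theta> in \<open>simp add: likelihood_ratio_nonneg\<close>)+
    show ?thesis by (simp only: *[symmetric] mult_ac)
  qed
  also have "\<dots> = (\<integral>\<^sup>+x. ennreal (likelihood_ratio \<theta> \<theta>' x) * indicator A x \<partial>two_point a \<theta>)"
    by (rule nn_integral_two_point[symmetric]) (use \<theta> in auto)
  also have "\<dots> = emeasure (density (two_point a \<theta>) (\<lambda>x. ennreal (likelihood_ratio \<theta> \<theta>' x))) A"
    by (rule emeasure_density[symmetric]) auto
  finally show "emeasure (two_point a \<theta>') A =
    emeasure (density (two_point a \<theta>) (\<lambda>x. ennreal (likelihood_ratio \<theta> \<theta>' x))) A" .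
qed simp

text \<open>The excess over 1 is the chi-square divergence: the squared step times the Fisher
  information \<open>1 / (1 - \<theta>\<^sup>2)\<close> of the two-point law.\<close>

lemma integral_likelihood_ratio_square:
  assumes a: "a > 0" and \<theta>: "\<bar>\<theta>\<bar> < 1"
  shows "(\<integral>x. (likelihood_ratio \<theta> \<theta>' x)\<^sup>2 \<partial>two_point a \<theta>) = 1 + (\<theta>' - \<theta>)\<^sup>2 / (1 - \<theta>\<^sup>2)"
proof -
  have nz: "1 + \<theta> \<noteq> 0" "1 - \<theta> \<noteq> 0" using \<theta> by auto
  have sq: "1 - \<theta>\<^sup>2 = (1 + \<theta>) * (1 - \<theta>)" by (simp add: power2_eq_square algebra_simps)
  have "(\<integral>x. (likelihood_ratio \<theta> \<theta>' x)\<^sup>2 \<partial>two_point a \<theta>) =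
      (1 + \<theta>) / 2 * ((1 + \<theta>') / (1 + \<theta>))\<^sup>2 + (1 - \<theta>) / 2 * ((1 - \<theta>') / (1 - \<theta>))\<^sup>2"
    using a \<theta> by (simp add: integral_two_point likelihood_ratio_def)
  also have "\<dots> = 1 + (\<theta>' - \<theta>)\<^sup>2 / (1 - \<theta>\<^sup>2)"
  proof -
    \<comment> \<open>Here \<open>u\<close> and \<open>v\<close> are twice the masses of the two
      atoms, so they sum to 2; likewise \<open>u'\<close> and \<open>v'\<close>.\<close>
    have "u / 2 * (u' / u)\<^sup>2 + v / 2 * (v' / v)\<^sup>2 = 1 + (u' - u)\<^sup>2 / (u * v)"
      if "u \<noteq> 0" "v \<noteq> 0" "v = 2 - u" "v' = 2 - u'" for u v u' v' :: real
    proof -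
      have "u / 2 * (u' / u)\<^sup>2 + v / 2 * (v' / v)\<^sup>2 = (u'\<^sup>2 * v + v'\<^sup>2 * u) / (2 * (u * v))"
        using that(1,2) by (simp add: power2_eq_square field_simps)
      also have "u'\<^sup>2 * v + v'\<^sup>2 * u = 2 * (u * v) + 2 * (u' - u)\<^sup>2"
        unfolding that(3,4) by (simp add: power2_eq_square algebra_simps)
      also have "\<dots> / (2 * (u * v)) = 1 + (u' - u)\<^sup>2 / (u * v)"
        using that(1,2) by (simp add: add_divide_distrib)
      finally show ?thesis .
    qed
    from this[OF nz, of "1 - \<theta>'" "1 + \<theta>'"] show ?thesis
      unfolding sq by (simp only: add_diff_add diff_self add_0_left) simp
  qed
  finally show ?thesis .
qed

subsection \<open>Two-armed instances\<close>

definition pair :: "real \<Rightarrow> real \<Rightarrow> instance_laws" where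
  "pair a \<theta> = [two_point a 0, two_point a \<theta>]"

lemma length_pair [simp]: "length (pair a \<theta>) = 2"
  by (simp add: pair_def)

lemma pair_in_P_sg:
  assumes "0 < a" "a \<le> M" "a \<le> \<sigma>" "2 \<le> Kbar" and \<theta>: "\<bar>\<theta>\<bar> \<le> 1"
  shows "pair a \<theta> \<in> P_sg M \<sigma> Kbar"
proof -
  have "\<bar>a * \<theta>\<bar> \<le> M"
    using mult_mono[of "\<bar>a\<bar>" M "\<bar>\<theta>\<bar>" 1] assms by (simp add: abs_mult)
  then show ?thesis
    using assms
    by (auto simp: P_sg_def pair_def prob_space_two_point mean_two_point abs_le_iff
        intro: integrable_two_point sub_gaussian_two_point)
qed

lemma gap_pair:
  assumes "a > 0" "0 \<le> \<theta>" "\<theta> \<le> 1"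
  shows "gap (pair a \<theta>) 0 = a * \<theta>" "gap (pair a \<theta>) 1 = 0"
proof -
  have "{..<2} = {0, 1::nat}" by auto
  moreover have "max 0 (a * \<theta>) = a * \<theta>" using assms by simp
  ultimately show "gap (pair a \<theta>) 0 = a * \<theta>" "gap (pair a \<theta>) 1 = 0"
    unfolding gap_def length_pair using assms(2,3) by (simp_all add: pair_def mean_two_point)
qed

text \<open>For nonnegative \<open>\<theta>\<close> arm 1 is optimal, so arm 0 alone causes
  regret.\<close>

lemma regret_pair:
  assumes "a > 0" "0 \<le> \<theta>" "\<theta> \<le> 1"
  shows "regret alg (pair a \<theta>) T = a * \<theta> * expected_pulls alg (pair a \<theta>) T 0"
  unfolding regret_def using gap_pair[OF assms] by (simp add: numeral_2_eq_2)

lemma expected_pulls_pair: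
  assumes "decision_rules alg"
  shows "expected_pulls alg (pair a \<theta>) T 0 + expected_pulls alg (pair a \<theta>) T 1 = real T"
proof -
  have "(\<Sum>i<2. expected_pulls alg (pair a \<theta>) T i) = real T"
    by (rule sum_expected_pulls) (auto simp: assms pair_def prob_space_two_point)
  then show ?thesis by (simp add: numeral_2_eq_2)
qed

text \<open>The second moment of the likelihood ratio factorises over the cells. The cells of arm 0
  contribute 1, and all \<open>T\<close> cells of arm 1 are counted, read or not; hence the power
  \<open>T\<close>.\<close>

lemma pulls_Chapman_Robbins:
  assumes alg: "decision_rules alg" and a: "a > 0" and \<theta>: "\<bar>\<theta>\<bar> < 1" "\<bar>\<theta>'\<bar> \<le> 1"
  shows "(expected_pulls alg (pair a \<theta>') T i - expected_pulls alg (pair a \<theta>) T i)\<^sup>2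
    \<le> ((1 + (\<theta>' - \<theta>)\<^sup>2 / (1 - \<theta>\<^sup>2)) ^ T - 1) * variance_pulls alg (pair a \<theta>) T i"
proof -
  let ?L = "{as. set as \<subseteq> {..<2::nat} \<and> length as = T}" and ?J = "{..<2::nat} \<times> {..<T}"
  let ?w = "\<lambda>X. pmf (arms_pmf (alg T 2) X T)"
  \<comment> \<open>The parameter of each cell, which puts both arms into a single family of
    two-point laws.\<close>
  define par where "par \<eta> j = (if fst j = (0::nat) then 0 else \<eta>)" for \<eta> :: real and j :: "nat \<times> nat"
  define N where "N \<eta> j = two_point a (par \<eta> j)" for \<eta> j
  define P where "P \<eta> = PiM ?J (N \<eta>)" for \<eta>
  define h where "h X = (\<Prod>j\<in>?J. likelihood_ratio (par \<theta> j) (par \<theta>' j) (X j))"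
    for X :: "nat \<times> nat \<Rightarrow> real"
  have par: "\<bar>par \<theta> j\<bar> < 1" "\<bar>par \<theta>' j\<bar> \<le> 1" for j using \<theta> by (auto simp: par_def)
  have N: "prob_space (N \<eta> j)" "sets (N \<eta> j) = sets borel" for \<eta> j
    by (auto simp: N_def prob_space_two_point)
  have PP: "prob_space (P \<eta>)" for \<eta> unfolding P_def by (intro prob_space_PiM N)
  have law: "(\<integral>as. F as \<partial>action_law alg (pair a \<eta>) T) = (\<integral>X. (\<Sum>as\<in>?L. F as * ?w X as) \<partial>P \<eta>)" for F \<eta>
  proof -
    have "(\<Pi>\<^sub>M (i, s)\<in>?J. pair a \<eta> ! i) = P \<eta>"
      unfolding P_def N_def par_def pair_def by (rule PiM_cong) (auto simp: less_2_cases_iff)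
    moreover have "(\<integral>as. F as \<partial>action_law alg (pair a \<eta>) T) =
        (\<integral>X. (\<Sum>as\<in>?L. F as * ?w X as) \<partial>(\<Pi>\<^sub>M (i, s)\<in>?J. pair a \<eta> ! i))"
      by (rule integral_action_law[OF alg]) (auto simp: pair_def prob_space_two_point)
    ultimately show ?thesis by simp
  qed
  interpret product_prob_space "N \<theta>" ?J by (intro product_prob_spaceI N)
  have mr: "likelihood_ratio \<eta> \<eta>' \<in> borel_measurable (N \<theta> j)" for \<eta> \<eta>' j
    by (simp add: measurable_cong_sets[OF N(2) refl])
  have "P \<theta>' = density (P \<theta>) (\<lambda>X. \<Prod>j\<in>?J. ennreal (likelihood_ratio (par \<theta> j) (par \<theta>' j) (X j)))"
    unfolding P_def
  proof (rule PiM_density)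
    show "N \<theta>' j = density (N \<theta> j) (\<lambda>x. ennreal (likelihood_ratio (par \<theta> j) (par \<theta>' j) x))" for j
      unfolding N_def using a par by (rule two_point_density)
    show "(\<lambda>x. ennreal (likelihood_ratio (par \<theta> j) (par \<theta>' j) x)) \<in> borel_measurable (N \<theta> j)" for j
      using mr by measurable
  qed (simp_all add: N)
  also have "(\<lambda>X. \<Prod>j\<in>?J. ennreal (likelihood_ratio (par \<theta> j) (par \<theta>' j) (X j))) = (\<lambda>X. ennreal (h X))"
    unfolding h_def using par by (auto intro!: prod_ennreal likelihood_ratio_nonneg)
  finally have dens: "P \<theta>' = density (P \<theta>) (\<lambda>X. ennreal (h X))" .
  have mh: "h \<in> borel_measurable (P \<theta>)"
    unfolding h_def P_def
  proof (rule borel_measurable_prod)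
    fix j assume "j \<in> ?J"
    then show "(\<lambda>X. likelihood_ratio (par \<theta> j) (par \<theta>' j) (X j)) \<in> borel_measurable (PiM ?J (N \<theta>))"
      by (intro measurable_compose[where f = "\<lambda>X. X j", OF _ mr[of _ _ j]] measurable_component_singleton)
  qed
  have h2: "(h X)\<^sup>2 = (\<Prod>j\<in>?J. (likelihood_ratio (par \<theta> j) (par \<theta>' j) (X j))\<^sup>2)" for X
    unfolding h_def by (simp add: prod_power_distrib)
  have ir: "integrable (N \<theta> j) (\<lambda>x. (likelihood_ratio (par \<theta> j) (par \<theta>' j) x)\<^sup>2)" for j
    unfolding N_def by (rule integrable_two_point) simp
  have ih2: "integrable (P \<theta>) (\<lambda>X. (h X)\<^sup>2)"
    unfolding h2 P_def by (intro product_integrable_prod ir) simp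
  have "(\<integral>X. (h X)\<^sup>2 \<partial>P \<theta>) = (\<Prod>j\<in>?J. \<integral>x. (likelihood_ratio (par \<theta> j) (par \<theta>' j) x)\<^sup>2 \<partial>N \<theta> j)"
    unfolding h2 P_def by (intro product_integral_prod ir) simp
  also have "\<dots> = (\<Prod>j\<in>?J. 1 + (par \<theta>' j - par \<theta> j)\<^sup>2 / (1 - (par \<theta> j)\<^sup>2))"
    unfolding N_def using a par by (intro prod.cong refl integral_likelihood_ratio_square)
  also have "\<dots> = (\<Prod>i<2. \<Prod>s<T. 1 + (par \<theta>' (i, s) - par \<theta> (i, s))\<^sup>2 / (1 - (par \<theta> (i, s))\<^sup>2))"
    by (simp add: prod.cartesian_product case_prod_beta)
  also have "\<dots> = (1 + (\<theta>' - \<theta>)\<^sup>2 / (1 - \<theta>\<^sup>2)) ^ T"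
    by (simp add: numeral_2_eq_2 par_def)
  finally have Eh2: "(\<integral>X. (h X)\<^sup>2 \<partial>P \<theta>) = (1 + (\<theta>' - \<theta>)\<^sup>2 / (1 - \<theta>\<^sup>2)) ^ T" .
  have "((\<integral>X. (\<Sum>as\<in>?L. num_pulls i as * ?w X as) \<partial>density (P \<theta>) (\<lambda>X. ennreal (h X))) -
        (\<integral>X. (\<Sum>as\<in>?L. num_pulls i as * ?w X as) \<partial>P \<theta>))\<^sup>2
      \<le> ((\<integral>X. (h X)\<^sup>2 \<partial>P \<theta>) - 1) *
        (\<integral>X. (\<Sum>as\<in>?L. (num_pulls i as - (\<integral>X. (\<Sum>as\<in>?L. num_pulls i as * ?w X as) \<partial>P \<theta>))\<^sup>2 * ?w X as) \<partial>P \<theta>)"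
  proof (rule Chapman_Robbins)
    show "prob_space (density (P \<theta>) (\<lambda>X. ennreal (h X)))"
      unfolding dens[symmetric] by (rule PP)
    show "0 \<le> h X" for X
      unfolding h_def by (intro prod_nonneg likelihood_ratio_nonneg ballI par)
    show "finite ?L" by (rule finite_lists_length_eq) simp
    show "(\<lambda>X. ?w X as) \<in> borel_measurable (P \<theta>)" if "as \<in> ?L" for as
      unfolding P_def
      using measurable_pmf_arms_pmf[OF alg _ N(2), of 2 T ?J as] that by auto
    show "(\<Sum>as\<in>?L. ?w X as) = 1" for X
      by (rule sum_pmf_arms_pmf) (use alg in auto)
  qed (simp_all add: PP mh ih2)
  then show ?thesis
    unfolding Eh2 dens[symmetric] law[symmetric] expected_pulls_def variance_pulls_def .
qed

section \<open>From a drop in expected pulls to the variability\<close>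

text \<open>Linearises the divergence of \<open>n\<close> samples as long as the total
  \<open>n * x\<close> is at most 1, via \<open>exp y \<le> 1 + y + y\<^sup>2\<close> on the unit
  interval.\<close>

lemma one_plus_power_le:
  fixes x :: real
  assumes "0 \<le> x" "real n * x \<le> 1"
  shows "(1 + x) ^ n - 1 \<le> 2 * (real n * x)"
proof -
  have "(1 + x) ^ n \<le> exp x ^ n"
    using assms by (intro power_mono exp_ge_add_one_self) auto
  also have "\<dots> = exp (real n * x)" by (simp add: exp_of_nat_mult)
  also have "\<dots> \<le> 1 + real n * x + (real n * x)\<^sup>2"
    using assms by (intro exp_bound) auto
  also have "(real n * x)\<^sup>2 \<le> real n * x"
    unfolding power2_eq_square using assms by (intro mult_left_le) auto
  finally show ?thesis by linarith
qed

lemma variability_lower_bound: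
  assumes alg: "decision_rules alg" and a: "a > 0" and \<Theta>: "0 < \<Theta>" "\<Theta> \<le> 1 / 2" and T: "T > 0"
    and drop: "real T / 4 \<le> expected_pulls alg (pair a 0) T 0 - expected_pulls alg (pair a \<Theta>) T 0"
  shows "\<exists>\<theta>\<in>{0..\<Theta>}. sqrt (real T) / 8 \<le> \<Theta> * variability alg (pair a \<theta>) T"
proof -
  define t where "t k = real k * \<Theta> / real T" for k
  define e where "e k = expected_pulls alg (pair a (t k)) T 0" for k
  \<comment> \<open>Pigeonhole: \<open>T\<close> consecutive drops add up to at least
    \<open>T / 4\<close>.\<close>
  have "\<exists>k<T. 1 / 4 \<le> e k - e (Suc k)"
  proof (rule ccontr)
    assume "\<not> ?thesis"
    then have "(\<Sum>k<T. e k - e (Suc k)) < (\<Sum>k<T. 1 / 4)"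
      using T by (intro sum_strict_mono) auto
    also have "(\<Sum>k<T. e k - e (Suc k)) = e 0 - e T" by (rule sum_lessThan_telescope')
    finally show False using drop T by (simp add: e_def t_def)
  qed
  then obtain k where k: "k < T" "1 / 4 \<le> e k - e (Suc k)" by blast
  have tk: "0 \<le> t k" "t k \<le> \<Theta>" "t (Suc k) \<le> \<Theta>" "0 \<le> t (Suc k)"
    using k(1) \<Theta> by (auto simp: t_def divide_le_eq mult_right_mono)
  define V where "V = variance_pulls alg (pair a (t k)) T 0"
  define x where "x = (t (Suc k) - t k)\<^sup>2 / (1 - (t k)\<^sup>2)"
  have V0: "V \<ge> 0" unfolding V_def variance_pulls_def by simp
  have "(t k)\<^sup>2 \<le> (1 / 2)\<^sup>2" using tk \<Theta> by (intro power_mono) auto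
  \<comment> \<open>The bound \<open>1 / 2\<close> on the parameter keeps the Fisher information at
    most \<open>4 / 3\<close>.\<close>
  then have den: "1 - (t k)\<^sup>2 \<ge> 3 / 4" by (simp add: power2_eq_square)
  have diff: "t (Suc k) - t k = \<Theta> / real T" by (simp add: t_def algebra_simps add_divide_distrib)
  have x0: "0 \<le> x" unfolding x_def using den by simp
  have "x \<le> (\<Theta> / real T)\<^sup>2 / (3 / 4)"
    unfolding x_def diff using den by (intro divide_left_mono) auto
  then have xle: "real T * x \<le> 4 / 3 * \<Theta>\<^sup>2 / real T"
    using T by (simp add: field_simps power2_eq_square)
  have "\<Theta>\<^sup>2 \<le> (1 / 2)\<^sup>2" using \<Theta> by (intro power_mono) auto
  then have "4 / 3 * \<Theta>\<^sup>2 / real T \<le> 1" using T by (simp add: power2_eq_square field_simps)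
  with xle have x1: "real T * x \<le> 1" by linarith
  have "(1 / 4)\<^sup>2 \<le> (e k - e (Suc k))\<^sup>2" using k(2) by (intro power_mono) auto
  also have "\<dots> = (e (Suc k) - e k)\<^sup>2" by (rule power2_commute)
  also have "\<dots> \<le> ((1 + x) ^ T - 1) * V"
    unfolding e_def x_def V_def using tk \<Theta> by (intro pulls_Chapman_Robbins alg a) auto
  also have "\<dots> \<le> (2 * (4 / 3 * \<Theta>\<^sup>2 / real T)) * V"
    using one_plus_power_le[OF x0 x1] xle by (intro mult_right_mono V0) linarith
  finally have "real T * 3 / 128 \<le> \<Theta>\<^sup>2 * V"
    using T by (simp add: power2_eq_square field_simps)
  \<comment> \<open>The factor \<open>3 / 128\<close> is lowered to \<open>1 / 64\<close> for the
    sake of a rational square root.\<close>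
  then have "real T / 64 \<le> \<Theta>\<^sup>2 * V" by simp
  then have "sqrt (real T / 64) \<le> sqrt (\<Theta>\<^sup>2 * V)" by (rule real_sqrt_le_mono)
  also have "sqrt (real T / 64) = sqrt (real T) / 8"
    by (simp add: real_sqrt_divide)
  also have "sqrt (\<Theta>\<^sup>2 * V) = \<Theta> * sqrt V"
    using \<Theta> by (simp add: real_sqrt_mult)
  also have "\<dots> \<le> \<Theta> * variability alg (pair a (t k)) T"
    unfolding variability_def V_def using \<Theta> by (intro mult_left_mono Max_ge) auto
  finally show ?thesis using tk by auto
qed

section \<open>Choice of the constant and passage to the limit\<close>

theorem theorem1:
  fixes M \<sigma> :: real and Kbar :: nat
  assumes "M > 0" and "\<sigma> > 0" and "Kbar \<ge> 2"
  shows "\<exists>C>0. \<forall>alg.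
           bandit_algorithm M \<sigma> Kbar alg \<longrightarrow> active_learning M \<sigma> Kbar alg \<longrightarrow>
           liminf (\<lambda>T. worst_regret M \<sigma> Kbar alg T * worst_variability M \<sigma> Kbar alg T
                         / ereal (real T powr (3 / 2)))
             > ereal C"
proof -
  \<comment> \<open>The largest scale at which every pair meets both the mean bound and the
    sub-Gaussian bound.\<close>
  define a where "a = min M \<sigma>"
  have a: "0 < a" "a \<le> M" "a \<le> \<sigma>" using assms by (auto simp: a_def)
  have "ereal (a / 64) < liminf (\<lambda>T. worst_regret M \<sigma> Kbar alg T * worst_variability M \<sigma> Kbar alg T
      / ereal (real T powr (3 / 2)))"
    if alg: "bandit_algorithm M \<sigma> Kbar alg" and act: "active_learning M \<sigma> Kbar alg" for alg
  proof -
    let ?R = "worst_regret M \<sigma> Kbar alg" and ?S = "worst_variability M \<sigma> Kbar alg"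
    have dr: "decision_rules alg" using alg by (simp add: bandit_algorithm_def)
    have P: "pair a \<theta> \<in> P_sg M \<sigma> Kbar" if "\<bar>\<theta>\<bar> \<le> 1" for \<theta>
      using a assms(3) that by (rule pair_in_P_sg)
    \<comment> \<open>\<open>T \<ge> 2\<close> lets every arm of a pair be pulled once; the
      threshold \<open>a / 8\<close> is what makes \<open>\<Theta>\<close> at most
      \<open>1 / 2\<close>.\<close>
    have ev: "ereal (a / 32) \<le> ?R T * ?S T / ereal (real T powr (3 / 2))"
      if T: "T \<ge> 2" and small: "?R T / ereal (real T) < ereal (a / 8)" for T
    proof -
      have R: "ereal (a * \<theta> * expected_pulls alg (pair a \<theta>) T 0) \<le> ?R T" if "0 \<le> \<theta>" "\<theta> \<le> 1" for \<theta>
        unfolding worst_regret_def regret_pair[OF a(1) that, symmetric]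
        by (rule SUP_upper) (use P that in auto)
      \<comment> \<open>The obligatory pull of arm 0, whose gap is \<open>a\<close> at parameter 1,
        bounds the worst regret away from 0. Hence \<open>r\<close> and \<open>\<Theta>\<close> are
        positive.\<close>
      have "1 \<le> expected_pulls alg (pair a 1) T 0"
        using alg P[of 1] T unfolding bandit_algorithm_def by (auto simp: Ball_def)
      then have "a \<le> a * 1 * expected_pulls alg (pair a 1) T 0" using a by simp
      then have Ra: "ereal a \<le> ?R T"
        using R[of 1] by (auto intro: order.trans[of _ "ereal (a * 1 * expected_pulls alg (pair a 1) T 0)"])
      have "?R T \<noteq> \<infinity>" using small T by auto
      then obtain r where r: "?R T = ereal r" using Ra by (cases "?R T") auto
      have r0: "r > 0" using Ra a r by simp
      \<comment> \<open>Chosen so that regret at most \<open>r\<close> at gap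
        \<open>a * \<Theta>\<close> leaves arm 0 at most \<open>T / 4\<close> expected
        pulls.\<close>
      define \<Theta> where "\<Theta> = 4 * r / (a * real T)"
      have \<Theta>: "0 < \<Theta>" "\<Theta> \<le> 1 / 2"
        using r0 a T small r by (auto simp: \<Theta>_def field_simps)
      \<comment> \<open>Both arms have the same law at parameter 0, so the symmetry assumption
        applies.\<close>
      have "expected_pulls alg (pair a 0) T 0 = expected_pulls alg (pair a 0) T 1"
        using alg P[of 0] unfolding bandit_algorithm_def by (auto simp: pair_def)
      then have E0: "expected_pulls alg (pair a 0) T 0 = real T / 2"
        using expected_pulls_pair[OF dr, of a 0 T] by simp
      have "a * \<Theta> * expected_pulls alg (pair a \<Theta>) T 0 \<le> r"
        using R[of \<Theta>] \<Theta> r by simp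
      then have "expected_pulls alg (pair a \<Theta>) T 0 \<le> real T / 4"
        using r0 a T by (simp add: \<Theta>_def field_simps)
      then obtain \<theta> where \<theta>: "\<theta> \<in> {0..\<Theta>}" "sqrt (real T) / 8 \<le> \<Theta> * variability alg (pair a \<theta>) T"
        using variability_lower_bound[OF dr a(1) \<Theta>, of T] E0 T by auto
      let ?v = "variability alg (pair a \<theta>) T"
      have "real T powr (3 / 2) = real T * sqrt (real T)"
        using T powr_add[of "real T" 1 "1 / 2"] by (simp add: powr_half_sqrt)
      also have "a / 32 * \<dots> = a * real T / 4 * (sqrt (real T) / 8)" by simp
      also have "\<dots> \<le> a * real T / 4 * (\<Theta> * ?v)"
        using a \<theta>(2) by (intro mult_left_mono) auto
      also have "\<dots> = r * ?v" using a T by (simp add: \<Theta>_def)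
      finally have "ereal (a / 32 * real T powr (3 / 2)) \<le> ereal r * ereal ?v" by simp
      also have "\<dots> \<le> ?R T * ?S T"
        unfolding r worst_variability_def using r0 \<theta> \<Theta> P
        by (intro ereal_mult_left_mono SUP_upper) auto
      finally show ?thesis
        using T by (intro ereal_le_divide_pos[THEN iffD2]) (auto simp: mult.commute)
    qed
    have "eventually (\<lambda>T. ?R T / ereal (real T) < ereal (a / 8)) sequentially"
      using act a unfolding active_learning_def by (intro order_tendstoD(2)) auto
    then have "eventually (\<lambda>T. ereal (a / 32) \<le> ?R T * ?S T / ereal (real T powr (3 / 2))) sequentially"
      using eventually_ge_at_top[of 2] by eventually_elim (rule ev)
    then have "ereal (a / 32) \<le> liminf (\<lambda>T. ?R T * ?S T / ereal (real T powr (3 / 2)))"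
      by (rule Liminf_bounded)
    \<comment> \<open>Halving the constant turns the weak bound on the lower limit into the strict
      one required.\<close>
    moreover have "ereal (a / 64) < ereal (a / 32)" using a by simp
    ultimately show ?thesis by (rule less_le_trans[rotated])
  qed
  then show ?thesis using a by (intro exI[of _ "a / 64"]) auto
qed

end
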